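(* Let $r\ge 2$ be an integer, let $\Gamma\colon \mathfrak{G}^{r}\to\mathbb{R}_{\ge 0}$ be a map that is $k$-uniform for some real $k$, $(\delta_\ast,c_\ast,C_\ast)$-smooth for some $\delta_\ast\in(0,1]$, $c_\ast>0$, $C_\ast>0$, locally $C$-Lipschitz for some $C>0$, continuous, and locally monotone, and let $\mathfrak{H}$ be a hereditary family of $r$-graphs. Suppose that (i) $\Gamma$ is symmetrization-increasing, (ii) $\Gamma$ is symmetrized-stable with respect to $\mathfrak{H}$, and (iii) $\Gamma$ is vertex-extendable with respect to $\mathfrak{H}$. Then $\Gamma$ is degree-stable with respect to $\mathfrak{H}$.
   Context: An $r$-graph is a set of $r$-subsets (edges) of a finite vertex set $V(\mathcal{H})$; $v(\mathcal{H})=|V(\mathcal{H})|$. $\mathfrak{G}^r$ is the collection of all vertex-labeled $r$-graphs and $\mathfrak{G}^r(n)$ those with $n$ vertices. For $\mathcal{H}$ and $v\in V(\mathcal{H})$, $\mathcal{H}-v$ is obtained by deleting $v$ and all edges containing it; for $S\subset V(\mathcal{H})$, $\mathcal{H}-S$ is the induced subgraph on $V(\mathcal{H})\setminus S$. The link of $v$ is $L_{\mathcal{H}}(v)=\{e\in\binom{V(\mathcal{H})}{r-1}: e\cup\{v\}\in\mathcal{H}\}$. A family $\mathfrak{H}$ of $r$-graphs is hereditary if $F\in\mathfrak{H}$ implies every (not necessarily induced) subgraph of $F$ is in $\mathfrak{H}$. For $\Gamma\colon\mathfrak{G}^r\to\mathbb{R}$: the $\Gamma$-degree of $v$ in $\mathcal{H}$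 is $d_{\Gamma,\mathcal{H}}(v)=\Gamma(\mathcal{H})-\Gamma(\mathcal{H}-v)$, and $\delta_\Gamma(\mathcal{H})$ is the minimum $\Gamma$-degree; $\mathcal{H}$ is $\Gamma$-positive if $\Gamma(\mathcal{H})>0$; $\mathrm{ex}_\Gamma(n)=\max\{\Gamma(\mathcal{H}):\mathcal{H}\in\mathfrak{G}^r(n)\}$. All $o(\cdot)$ terms are as $n\to\infty$, uniformly over the $r$-graphs involved. $\Gamma$ is $k$-uniform if for every $n$ and every $\Gamma$-positive $\mathcal{H}\in\mathfrak{G}^r(n)$, $|\sum_{v}d_{\Gamma,\mathcal{H}}(v)-k\Gamma(\mathcal{H})|=o(\mathrm{ex}_\Gamma(n))$; then $\mathrm{exdeg}_\Gamma(n)=k\,\mathrm{ex}_\Gamma(n)/n$. "Uniform" means $k$-uniform for some $k$. $\Gamma$ (into $\mathbb{R}_{\ge0}$, $k$-uniform) is $(\delta_\ast,c_\ast,C_\ast)$-smooth if for every $n$ and $\delta\in[0,\delta_\ast]$: $\mathrm{ex}_\Gamma(n-\delta n)\le \mathrm{ex}_\Gamma(n)-\delta k\,\mathrm{ex}_\Gamma(n)+C_\ast\delta^{1+c_\ast}\mathrm{ex}_\Gamma(n)+o(\mathrm{ex}_\Gamma(n))$. $\Gamma$ is locally $C$-Lipschitz if for every $\Gamma$-positive $n$-vertex $\mathcal{H}$, every induced subgraph $\mathcal{H}'$ on $n'\le n$ vertices and every $v\in V(\mathcal{H}')$: $d_{\Gamma,\mathcal{H}'}(v)\ge d_{\Gamma,\mathcal{H}}(v)-\frac{C(n-n')}{n}\mathrm{exdeg}_\Gamma(n)-o(\mathrm{exdeg}_\Gamma(n))$.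 $\Gamma$ is continuous if for every $\varepsilon>0$ there are $\delta>0,N_0$ such that for every $r$-graph $\mathcal{H}$ on $n\ge N_0$ vertices and every $\mathcal{H}'\subset\mathcal{H}$ with $|\mathcal{H}'|\ge|\mathcal{H}|-\delta n^r$, $\Gamma(\mathcal{H}')\ge\Gamma(\mathcal{H})-\varepsilon\,\mathrm{ex}_\Gamma(n)$. $\Gamma$ is locally monotone if for every $\Gamma$-positive $\mathcal{H}$, every subgraph $\mathcal{H}'\subset\mathcal{H}$ and every $v\in V(\mathcal{H}')$, $d_{\Gamma,\mathcal{H}'}(v)\le d_{\Gamma,\mathcal{H}}(v)$. A pair $u,v$ is uncovered if no edge contains both; $u,v$ are equivalent if $L_{\mathcal{H}}(u)=L_{\mathcal{H}}(v)$. $\mathcal{H}_{u\to v}=(\mathcal{H}\setminus\{E:u\in E\})\cup\{\{u\}\cup e:e\in L_{\mathcal{H}}(v)\}$. $\mathcal{H}$ is symmetrized if every uncovered pair is equivalent. $\Gamma$ is symmetrization-increasing if for every $\mathcal{H}$ and every uncovered pair $u,v$, either $\Gamma(\mathcal{H})<\max\{\Gamma(\mathcal{H}_{u\to v}),\Gamma(\mathcal{H}_{v\to u})\}$ or $\Gamma(\mathcal{H})=\Gamma(\mathcal{H}_{u\to v})=\Gamma(\mathcal{H}_{v\to u})$. With respect to $\mathfrak{H}$: $\Gamma$ is symmetrized-stable if every symmetrized $\Gamma$-positive $r$-graph is in $\mathfrak{H}$; $\Gamma$ is $(\varepsilon,N_0)$-degree-stable if every $r$-graph $\mathcal{H}$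 on $n\ge N_0$ vertices with $\delta_\Gamma(\mathcal{H})\ge(1-\varepsilon)\mathrm{exdeg}_\Gamma(n)$ lies in $\mathfrak{H}$; $\Gamma$ is $(\varepsilon,N_0)$-vertex-extendable if for every $n\ge N_0$, every $n$-vertex $\mathcal{H}$ with $\delta_\Gamma(\mathcal{H})\ge(1-\varepsilon)\mathrm{exdeg}_\Gamma(n)$ and $\mathcal{H}-v\in\mathfrak{H}$ for some $v$ satisfies $\mathcal{H}\in\mathfrak{H}$. "Degree-stable" / "vertex-extendable" mean these hold for some $\varepsilon>0$ and $N_0$.
   Formalization: Assumes in addition that exdeg_Γ(n) is nonzero for all large n (so k ≠ 0 and ex_Γ(n) ≠ 0 eventually); without this the claim fails, e.g. for Γ ≡ 0 and ℌ empty. The maximum defining ex_Γ(n) is assumed to exist. *)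

theory Defs
  imports "HOL-Library.Landau_Symbols" "HOL-Library.Infinite_Typeclass"
begin

text \<open>
  A hypergraph is a pair (vertex set, edge set), so isolated vertices matter. Vertex labels come
  from an ambient type. A map \<open>\<Gamma>\<close> on \<open>r\<close>-graphs is a total HOL function of which only the values
  on \<open>r\<close>-graphs are ever used; it need not be invariant under relabelling.
\<close>

type_synonym 'a hypergraph = "'a set \<times> 'a set set"

abbreviation verts :: "'a hypergraph \<Rightarrow> 'a set" where "verts \<equiv> fst"
abbreviation edges :: "'a hypergraph \<Rightarrow> 'a set set" where "edges \<equiv> snd"

definition rgraph :: "nat \<Rightarrow> 'a hypergraph \<Rightarrow> bool" where
  "rgraph r G \<longleftrightarrow> finite (verts G) \<and> (\<forall>e\<in>edges G. e \<subseteq> verts G \<and> card e = r)"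

definition rgraphs :: "nat \<Rightarrow> nat \<Rightarrow> 'a hypergraph set" where
  "rgraphs r n = {G. rgraph r G \<and> card (verts G) = n}"

definition subgraph :: "'a hypergraph \<Rightarrow> 'a hypergraph \<Rightarrow> bool" where
  "subgraph H G \<longleftrightarrow> verts H \<subseteq> verts G \<and> edges H \<subseteq> edges G"

definition induced :: "'a hypergraph \<Rightarrow> 'a set \<Rightarrow> 'a hypergraph" where
  "induced G S = (S, {e \<in> edges G. e \<subseteq> S})"

definition delete_vertex :: "'a hypergraph \<Rightarrow> 'a \<Rightarrow> 'a hypergraph" where
  "delete_vertex G v = (verts G - {v}, {e \<in> edges G. v \<notin> e})"

definition link :: "nat \<Rightarrow> 'a hypergraph \<Rightarrow> 'a \<Rightarrow> 'a set set" where
  "link r G v = {e. e \<subseteq> verts G \<and> card e = r - 1 \<and> e \<union> {v} \<in> edges G}"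

definition hereditary :: "nat \<Rightarrow> 'a hypergraph set \<Rightarrow> bool" where
  "hereditary r \<HH> \<longleftrightarrow>
     (\<forall>F\<in>\<HH>. rgraph r F) \<and> (\<forall>F\<in>\<HH>. \<forall>F'. rgraph r F' \<and> subgraph F' F \<longrightarrow> F' \<in> \<HH>)"


definition gdeg :: "('a hypergraph \<Rightarrow> real) \<Rightarrow> 'a hypergraph \<Rightarrow> 'a \<Rightarrow> real" where
  "gdeg \<Gamma> G v = \<Gamma> G - \<Gamma> (delete_vertex G v)"

text \<open>Unspecified for the graph without vertices.\<close>
definition min_gdeg :: "('a hypergraph \<Rightarrow> real) \<Rightarrow> 'a hypergraph \<Rightarrow> real" where
  "min_gdeg \<Gamma> G = Min (gdeg \<Gamma> G ` verts G)"

text \<open>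
  With infinitely many labels \<^term>\<open>rgraphs r n\<close> is infinite, so the maximum defining
  \<open>ex\<^sub>\<Gamma>(n)\<close> need not exist for an arbitrary \<open>\<Gamma>\<close>. Under \<open>has_extremal\<close> the supremum in
  \<open>ex_num\<close> is that maximum. Every relabelling-invariant \<open>\<Gamma>\<close> satisfies \<open>has_extremal\<close>
  (if the label type is infinite), having finitely many values on \<^term>\<open>rgraphs r n\<close>.
\<close>
definition has_extremal :: "nat \<Rightarrow> ('a hypergraph \<Rightarrow> real) \<Rightarrow> bool" where
  "has_extremal r \<Gamma> \<longleftrightarrow> (\<forall>n. \<exists>G\<in>rgraphs r n. \<forall>H\<in>rgraphs r n. \<Gamma> H \<le> \<Gamma> G)"

definition ex_num :: "nat \<Rightarrow> ('a hypergraph \<Rightarrow> real) \<Rightarrow> nat \<Rightarrow> real" where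
  "ex_num r \<Gamma> n = (SUP G\<in>rgraphs r n. \<Gamma> G)"

definition exdeg :: "nat \<Rightarrow> ('a hypergraph \<Rightarrow> real) \<Rightarrow> real \<Rightarrow> nat \<Rightarrow> real" where
  "exdeg r \<Gamma> k n = k * ex_num r \<Gamma> n / real n"


text \<open>
  Each error term is a single function \<open>f\<close> of \<open>n\<close>, chosen before the graphs, vertices and the
  parameter \<open>\<delta>\<close>; this is what makes it uniform.
\<close>

definition k_uniform :: "nat \<Rightarrow> ('a hypergraph \<Rightarrow> real) \<Rightarrow> real \<Rightarrow> bool" where
  "k_uniform r \<Gamma> k \<longleftrightarrow>
     (\<exists>f \<in> o(\<lambda>n. ex_num r \<Gamma> n). \<forall>n. \<forall>G\<in>rgraphs r n. \<Gamma> G > 0 \<longrightarrow>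
        \<bar>(\<Sum>v\<in>verts G. gdeg \<Gamma> G v) - k * \<Gamma> G\<bar> \<le> f n)"

text \<open>The number of vertices \<open>n - \<delta>n\<close> is \<open>m\<close>; only those \<open>\<delta>\<close> making it an integer are considered.\<close>
definition smooth :: "nat \<Rightarrow> ('a hypergraph \<Rightarrow> real) \<Rightarrow> real \<Rightarrow> real \<Rightarrow> real \<Rightarrow> real \<Rightarrow> bool" where
  "smooth r \<Gamma> k \<delta>s cs Cs \<longleftrightarrow>
     (\<exists>f \<in> o(\<lambda>n. ex_num r \<Gamma> n). \<forall>n m. \<forall>\<delta>\<in>{0..\<delta>s}. real m = real n - \<delta> * real n \<longrightarrow>
        ex_num r \<Gamma> m \<le> ex_num r \<Gamma> n - \<delta> * k * ex_num r \<Gamma> n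
                        + Cs * \<delta> powr (1 + cs) * ex_num r \<Gamma> n + f n)"

definition locally_lipschitz :: "nat \<Rightarrow> ('a hypergraph \<Rightarrow> real) \<Rightarrow> real \<Rightarrow> real \<Rightarrow> bool" where
  "locally_lipschitz r \<Gamma> k C \<longleftrightarrow>
     (\<exists>f \<in> o(\<lambda>n. exdeg r \<Gamma> k n). \<forall>n. \<forall>G\<in>rgraphs r n. \<Gamma> G > 0 \<longrightarrow>
        (\<forall>S \<subseteq> verts G. \<forall>v\<in>S.
           gdeg \<Gamma> (induced G S) v
             \<ge> gdeg \<Gamma> G v - C * (real n - real (card S)) / real n * exdeg r \<Gamma> k n - f n))"

text \<open>Only edges are removed here: the subgraph has the same vertex set.\<close>
definition removal_continuous :: "nat \<Rightarrow> ('a hypergraph \<Rightarrow> real) \<Rightarrow> bool" where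
  "removal_continuous r \<Gamma> \<longleftrightarrow>
     (\<forall>\<epsilon>>0. \<exists>\<delta>>0. \<exists>N0. \<forall>n\<ge>N0. \<forall>G\<in>rgraphs r n. \<forall>E \<subseteq> edges G.
        real (card E) \<ge> real (card (edges G)) - \<delta> * real n ^ r \<longrightarrow>
        \<Gamma> (verts G, E) \<ge> \<Gamma> G - \<epsilon> * ex_num r \<Gamma> n)"

definition locally_monotone :: "nat \<Rightarrow> ('a hypergraph \<Rightarrow> real) \<Rightarrow> bool" where
  "locally_monotone r \<Gamma> \<longleftrightarrow>
     (\<forall>G G'. rgraph r G \<and> \<Gamma> G > 0 \<and> rgraph r G' \<and> subgraph G' G \<longrightarrow>
        (\<forall>v\<in>verts G'. gdeg \<Gamma> G' v \<le> gdeg \<Gamma> G v))"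


definition uncovered :: "'a hypergraph \<Rightarrow> 'a \<Rightarrow> 'a \<Rightarrow> bool" where
  "uncovered G u v \<longleftrightarrow> u \<in> verts G \<and> v \<in> verts G \<and> u \<noteq> v \<and> \<not> (\<exists>e\<in>edges G. u \<in> e \<and> v \<in> e)"

text \<open>The graph obtained by making \<open>u\<close> a clone of \<open>v\<close>.\<close>
definition symmetrize :: "nat \<Rightarrow> 'a hypergraph \<Rightarrow> 'a \<Rightarrow> 'a \<Rightarrow> 'a hypergraph" where
  "symmetrize r G u v =
     (verts G, (edges G - {e \<in> edges G. u \<in> e}) \<union> {{u} \<union> e | e. e \<in> link r G v})"

definition symmetrized :: "nat \<Rightarrow> 'a hypergraph \<Rightarrow> bool" where
  "symmetrized r G \<longleftrightarrow> (\<forall>u v. uncovered G u v \<longrightarrow> link r G u = link r G v)"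

definition symmetrization_increasing :: "nat \<Rightarrow> ('a hypergraph \<Rightarrow> real) \<Rightarrow> bool" where
  "symmetrization_increasing r \<Gamma> \<longleftrightarrow>
     (\<forall>G u v. rgraph r G \<and> uncovered G u v \<longrightarrow>
        \<Gamma> G < max (\<Gamma> (symmetrize r G u v)) (\<Gamma> (symmetrize r G v u)) \<or>
        (\<Gamma> G = \<Gamma> (symmetrize r G u v) \<and> \<Gamma> G = \<Gamma> (symmetrize r G v u)))"


definition symmetrized_stable ::
  "nat \<Rightarrow> ('a hypergraph \<Rightarrow> real) \<Rightarrow> 'a hypergraph set \<Rightarrow> bool" where
  "symmetrized_stable r \<Gamma> \<HH> \<longleftrightarrow>
     (\<forall>G. rgraph r G \<and> symmetrized r G \<and> \<Gamma> G > 0 \<longrightarrow> G \<in> \<HH>)"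

definition degree_stable ::
  "nat \<Rightarrow> ('a hypergraph \<Rightarrow> real) \<Rightarrow> real \<Rightarrow> 'a hypergraph set \<Rightarrow> bool" where
  "degree_stable r \<Gamma> k \<HH> \<longleftrightarrow>
     (\<exists>\<epsilon>>0. \<exists>N0. \<forall>n\<ge>N0. \<forall>G\<in>rgraphs r n.
        min_gdeg \<Gamma> G \<ge> (1 - \<epsilon>) * exdeg r \<Gamma> k n \<longrightarrow> G \<in> \<HH>)"

definition vertex_extendable ::
  "nat \<Rightarrow> ('a hypergraph \<Rightarrow> real) \<Rightarrow> real \<Rightarrow> 'a hypergraph set \<Rightarrow> bool" where
  "vertex_extendable r \<Gamma> k \<HH> \<longleftrightarrow>
     (\<exists>\<epsilon>>0. \<exists>N0. \<forall>n\<ge>N0. \<forall>G\<in>rgraphs r n.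
        min_gdeg \<Gamma> G \<ge> (1 - \<epsilon>) * exdeg r \<Gamma> k n \<and>
        (\<exists>v\<in>verts G. delete_vertex G v \<in> \<HH>) \<longrightarrow> G \<in> \<HH>)"

text \<open>
  The notation \<open>o(exdeg\<^sub>\<Gamma>(n))\<close> presupposes that \<open>exdeg\<^sub>\<Gamma>(n)\<close> is nonzero for large \<open>n\<close>
  (equivalently \<open>k \<noteq> 0\<close> and \<open>ex\<^sub>\<Gamma>(n) \<noteq> 0\<close> for large \<open>n\<close>). Landau symbols in HOL do not, so this is
  stated separately. It cannot be dropped: if \<open>\<Gamma>\<close> vanishes identically, degree-stability would put
  all large \<open>r\<close>-graphs into \<open>\<HH>\<close>, while the hypotheses allow \<open>\<HH> = {}\<close>. For \<open>k = 0\<close> take \<open>\<Gamma>\<close>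
  equal to 1 on edgeless graphs and 0 elsewhere, and \<open>\<HH>\<close> the edgeless graphs.
\<close>
definition nondegenerate :: "nat \<Rightarrow> ('a hypergraph \<Rightarrow> real) \<Rightarrow> real \<Rightarrow> bool" where
  "nondegenerate r \<Gamma> k \<longleftrightarrow> (\<forall>\<^sub>F n in sequentially. exdeg r \<Gamma> k n \<noteq> 0)"

end

theory Submission
  imports Defs
begin

text \<open>
  Let \<open>Z(G)\<close> be the set of vertices of \<open>\<Gamma>\<close>-degree below \<open>(1 - \<epsilon>) exdeg(n)\<close>. Every nearly extremal \<open>G\<close>
  satisfies \<open>G - Z(G) \<in> \<HH>\<close>; if \<open>G\<close> has large minimum degree, it is nearly extremal by uniformity and
  \<open>Z(G)\<close> is empty. To see this, symmetrize one vertex at a time: \<open>\<Gamma>\<close> never decreases, so all graphs on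
  the way are nearly extremal, and the last one is symmetrized, hence in \<open>\<HH>\<close>. Going backwards, near
  extremality makes \<open>Z\<close> small by smoothness, so a step changes only a few vertices, and these can be put
  back one by one using vertex-extendability.
\<close>

section \<open>Hypergraph operations\<close>

lemma rgraph_induced: "rgraph r G \<Longrightarrow> S \<subseteq> verts G \<Longrightarrow> rgraph r (induced G S)"
  by (auto simp: rgraph_def induced_def intro: finite_subset)

lemma verts_induced [simp]: "verts (induced G S) = S"
  by (simp add: induced_def)

lemma induced_verts: "rgraph r G \<Longrightarrow> induced G (verts G) = G"
  by (cases G) (auto simp: rgraph_def induced_def)

lemma delete_vertex_induced: "delete_vertex (induced G S) v = induced G (S - {v})"
  by (auto simp: delete_vertex_def induced_def)

lemma subgraph_induced: "S \<subseteq> verts G \<Longrightarrow> subgraph (induced G S) G"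
  by (auto simp: subgraph_def induced_def)

lemma hereditary_induced:
  assumes "hereditary r \<HH>" "induced G T \<in> \<HH>" "S \<subseteq> T"
  shows "induced G S \<in> \<HH>"
proof -
  have "rgraph r (induced G T)"
    using assms by (auto simp: hereditary_def)
  then have "rgraph r (induced G S)"
    using \<open>S \<subseteq> T\<close> by (auto simp: rgraph_def induced_def intro: finite_subset)
  moreover have "subgraph (induced G S) (induced G T)"
    using \<open>S \<subseteq> T\<close> by (auto simp: subgraph_def induced_def)
  ultimately show ?thesis
    using assms unfolding hereditary_def by blast
qed

section \<open>Edges and links after symmetrizing one vertex\<close>

lemma uncovered_commute: "uncovered G u v \<longleftrightarrow> uncovered G v u"
  by (auto simp: uncovered_def)

lemma verts_symmetrize [simp]: "verts (symmetrize r G u v) = verts G"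
  by (simp add: symmetrize_def)

lemma induced_symmetrize: "u \<notin> S \<Longrightarrow> induced (symmetrize r G u v) S = induced G S"
  by (auto simp: induced_def symmetrize_def)

lemma link_not_mem:
  assumes "rgraph r G" "1 \<le> r" "f \<in> link r G x"
  shows "x \<notin> f"
proof
  assume "x \<in> f"
  then have "f \<union> {x} = f" by auto
  then show False using assms by (auto simp: link_def rgraph_def)
qed

text \<open>Exchanging \<open>v\<close> for \<open>u\<close> turns the edges of \<open>G\<close> at
  \<open>v\<close> into the new edges at \<open>u\<close>; since the pair is uncovered,
  \<open>u\<close> occurs in no member of the link of \<open>v\<close>. As \<open>e\<close> is an
  arbitrary set, \<open>v \<notin> e\<close> is what excludes the sets of \<open>r + 1\<close>
  elements that arise by adding \<open>u\<close> to an edge at \<open>v\<close>.\<close>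

lemma edges_symmetrize:
  assumes G: "rgraph r G" "1 \<le> r" and uv: "uncovered G u v"
  shows "e \<in> edges (symmetrize r G u v) \<longleftrightarrow>
    (if u \<in> e then v \<notin> e \<and> insert v (e - {u}) \<in> edges G else e \<in> edges G)"
proof (cases "u \<in> e")
  case True
  have "(\<exists>f. e = {u} \<union> f \<and> f \<in> link r G v) \<longleftrightarrow> v \<notin> e \<and> insert v (e - {u}) \<in> edges G"
  proof
    assume "\<exists>f. e = {u} \<union> f \<and> f \<in> link r G v"
    then obtain f where f: "e = {u} \<union> f" "f \<in> link r G v" by blast
    have "v \<notin> f" using link_not_mem[OF G f(2)] .
    moreover have "u \<notin> f" using f uv by (auto simp: link_def uncovered_def)
    ultimately show "v \<notin> e \<and> insert v (e - {u}) \<in> edges G"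
      using f uv by (auto simp: link_def uncovered_def)
  next
    assume a: "v \<notin> e \<and> insert v (e - {u}) \<in> edges G"
    then have s: "insert v (e - {u}) \<subseteq> verts G" "card (insert v (e - {u})) = r" "finite (verts G)"
      using G by (auto simp: rgraph_def)
    then have "finite (e - {u})" by (meson finite_insert finite_subset)
    then have "card (e - {u}) = r - 1" using s(2) a by simp
    then have "e - {u} \<in> link r G v" using a s by (auto simp: link_def)
    moreover have "e = {u} \<union> (e - {u})" using True by auto
    ultimately show "\<exists>f. e = {u} \<union> f \<and> f \<in> link r G v" by blast
  qed
  then show ?thesis using True by (simp add: symmetrize_def)
next
  case False
  then show ?thesis by (auto simp: symmetrize_def)
qed

lemma rgraph_symmetrize:
  assumes G: "rgraph r G" "1 \<le> r" and uv: "uncovered G u v"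
  shows "rgraph r (symmetrize r G u v)"
  unfolding rgraph_def
proof (intro conjI ballI)
  show "finite (verts (symmetrize r G u v))" using G by (simp add: rgraph_def)
  fix e assume "e \<in> edges (symmetrize r G u v)"
  then have e: "if u \<in> e then v \<notin> e \<and> insert v (e - {u}) \<in> edges G else e \<in> edges G"
    using edges_symmetrize[OF assms] by blast
  have u: "u \<in> verts G" using uv by (simp add: uncovered_def)
  have "e \<subseteq> verts G \<and> card e = r"
  proof (cases "u \<in> e")
    case True
    then have a: "v \<notin> e" "insert v (e - {u}) \<in> edges G" using e by auto
    then have s: "insert v (e - {u}) \<subseteq> verts G" "card (insert v (e - {u})) = r" "finite (verts G)"
      using G by (auto simp: rgraph_def)
    then have fin: "finite (e - {u})" by (meson finite_insert finite_subset)
    then have "Suc (card (e - {u})) = r" using s(2) a by simp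
    then have "card e = r" using fin True by (metis card_Suc_Diff1 finite_Diff2 finite.emptyI finite_insert)
    then show ?thesis using s(1) u by auto
  next
    case False
    then show ?thesis using e G by (auto simp: rgraph_def)
  qed
  then show "e \<subseteq> verts (symmetrize r G u v)" "card e = r" by auto
qed

text \<open>The exchange rule for edges passes to links, so the new link of \<open>x\<close> is
  determined by the old link of \<open>x\<close> alone. Hence vertices other than \<open>u\<close>
  that were equivalent remain equivalent.\<close>

lemma link_symmetrize_other:
  assumes G: "rgraph r G" "1 \<le> r" and uv: "uncovered G u v" and x: "x \<in> verts G" "x \<noteq> u"
  shows "f \<in> link r (symmetrize r G u v) x \<longleftrightarrow>
    (if u \<in> f then v \<notin> f \<and> insert v (f - {u}) \<in> link r G x else f \<in> link r G x)"
proof (cases "u \<in> f")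
  case True
  let ?h = "insert v (f - {u})"
  have uV: "u \<in> verts G" "v \<in> verts G" using uv by (auto simp: uncovered_def)
  have sub: "f \<subseteq> verts G \<longleftrightarrow> ?h \<subseteq> verts G" using uV by auto
  have ins: "insert v (f \<union> {x} - {u}) = ?h \<union> {x}" using x(2) by auto
  have card: "card ?h = card f" if "v \<notin> f" "f \<subseteq> verts G"
  proof -
    have "finite f" using that G by (auto simp: rgraph_def intro: finite_subset)
    then show ?thesis using that True by (simp add: card_Suc_Diff1 del: card_Diff_insert)
  qed
  have "f \<in> link r (symmetrize r G u v) x \<longleftrightarrow>
      f \<subseteq> verts G \<and> card f = r - 1 \<and> v \<notin> f \<union> {x} \<and> ?h \<union> {x} \<in> edges G"
    using True ins by (auto simp: link_def edges_symmetrize[OF G uv])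
  also have "\<dots> \<longleftrightarrow> v \<notin> f \<and> v \<noteq> x \<and> ?h \<in> link r G x"
    using sub card by (auto simp: link_def)
  \<comment> \<open>For \<open>x = v\<close> both sides fail, because \<open>?h\<close> contains
    \<open>v\<close>.\<close>
  also have "\<dots> \<longleftrightarrow> v \<notin> f \<and> ?h \<in> link r G x"
    using link_not_mem[OF G, of ?h x] by auto
  finally show ?thesis using True by simp
next
  case False
  then have "u \<notin> f \<union> {x}" using x by auto
  then show ?thesis using False by (simp add: link_def edges_symmetrize[OF G uv])
qed

text \<open>Both links coincide with the old link of \<open>v\<close>: no edge at \<open>v\<close>
  contains \<open>u\<close>, so replacing the edges at \<open>u\<close> leaves the link of
  \<open>v\<close> alone.\<close>

lemma link_symmetrize_eq:
  assumes G: "rgraph r G" "1 \<le> r" and uv: "uncovered G u v"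
  shows "link r (symmetrize r G u v) u = link r (symmetrize r G u v) v"
proof -
  have uV: "u \<in> verts G" "v \<in> verts G" "u \<noteq> v" using uv by (auto simp: uncovered_def)
  have "f \<in> link r (symmetrize r G u v) u \<longleftrightarrow> f \<in> link r (symmetrize r G u v) v" for f
  proof (cases "u \<in> f")
    case True
    have "f \<notin> link r (symmetrize r G u v) u"
      using link_not_mem[OF rgraph_symmetrize[OF G uv] G(2)] True by blast
    moreover have "insert v (f - {u}) \<notin> link r G v"
      using link_not_mem[OF G] by blast
    ultimately show ?thesis
      using True uV by (simp add: link_symmetrize_other[OF G uv])
  next
    case False
    have eq: "insert v (f \<union> {u} - {u}) = f \<union> {v}" using False by auto
    have "f \<in> link r (symmetrize r G u v) u \<longleftrightarrow> v \<notin> f \<and> f \<in> link r G v"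
      using False uV eq by (auto simp: link_def edges_symmetrize[OF G uv])
    also have "\<dots> \<longleftrightarrow> f \<in> link r G v"
      using link_not_mem[OF G] by blast
    finally show ?thesis
      using False uV by (simp add: link_symmetrize_other[OF G uv])
  qed
  then show ?thesis by blast
qed

section \<open>Symmetrization terminates\<close>

text \<open>The pairs are ordered and include the diagonal, so their number is the sum of the
  squares of the sizes of the equivalence classes.\<close>

definition equiv_pairs :: "nat \<Rightarrow> 'a hypergraph \<Rightarrow> ('a \<times> 'a) set" where
  "equiv_pairs r G = {(x, y). x \<in> verts G \<and> y \<in> verts G \<and> link r G x = link r G y}"

definition twins :: "nat \<Rightarrow> 'a hypergraph \<Rightarrow> 'a \<Rightarrow> 'a set" where
  "twins r G x = {y \<in> verts G. link r G y = link r G x}"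

lemma finite_equiv_pairs: "rgraph r G \<Longrightarrow> finite (equiv_pairs r G)"
  by (rule finite_subset[of _ "verts G \<times> verts G"]) (auto simp: equiv_pairs_def rgraph_def)

text \<open>The vertex \<open>u\<close> moves from its own class, of size \<open>a\<close>, to that
  of \<open>v\<close>, of size \<open>b \<ge> a\<close>. Pairs avoiding \<open>u\<close> (the set
  \<open>A\<close>) survive, \<open>2a - 1\<close> pairs with \<open>u\<close> may be lost, and
  \<open>2b + 1\<close> are gained.\<close>

lemma card_equiv_pairs_symmetrize:
  assumes G: "rgraph r G" "1 \<le> r" and uv: "uncovered G u v"
    and ne: "link r G u \<noteq> link r G v"
    and le: "card (twins r G u) \<le> card (twins r G v)"
  shows "card (equiv_pairs r G) < card (equiv_pairs r (symmetrize r G u v))"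
proof -
  let ?G = "symmetrize r G u v" and ?cu = "twins r G u" and ?cv = "twins r G v"
  define A where "A = {(x, y) \<in> equiv_pairs r G. x \<noteq> u \<and> y \<noteq> u}"
  have uV: "u \<in> verts G" "v \<in> verts G" "u \<noteq> v" using uv by (auto simp: uncovered_def)
  have fin: "finite (verts G)" using G by (simp add: rgraph_def)
  have fA: "finite A"
    by (rule finite_subset[OF _ finite_equiv_pairs[OF G(1)]]) (auto simp: A_def)
  have fc: "finite ?cu" "finite ?cv" using fin by (auto simp: twins_def)
  have ucu: "u \<in> ?cu" using uV by (simp add: twins_def)
  have ucv: "u \<notin> ?cv" using ne by (simp add: twins_def)
  have keep: "link r ?G x = link r ?G y"
    if "link r G x = link r G y" "x \<in> verts G" "y \<in> verts G" "x \<noteq> u" "y \<noteq> u" for x y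
    using that by (intro set_eqI) (simp add: link_symmetrize_other[OF G uv])
  have "equiv_pairs r G \<subseteq> A \<union> ({u} \<times> ?cu \<union> (?cu - {u}) \<times> {u})"
    by (auto simp: equiv_pairs_def twins_def A_def)
  then have "card (equiv_pairs r G) \<le> card (A \<union> ({u} \<times> ?cu \<union> (?cu - {u}) \<times> {u}))"
    using fA fc by (intro card_mono) auto
  also have "\<dots> \<le> card A + (card ({u} \<times> ?cu) + card ((?cu - {u}) \<times> {u}))"
    by (intro order_trans[OF card_Un_le] add_mono order_refl card_Un_le)
  also have "\<dots> < card A + (card ({u} \<times> insert u ?cv) + card (?cv \<times> {u}))"
    using le fc ucu ucv by (simp add: card_cartesian_product card_Diff_singleton)
  also have "\<dots> = card (A \<union> ({u} \<times> insert u ?cv \<union> ?cv \<times> {u}))"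
  proof -
    have "card ({u} \<times> insert u ?cv \<union> ?cv \<times> {u}) = card ({u} \<times> insert u ?cv) + card (?cv \<times> {u})"
      using fc ucv by (intro card_Un_disjoint) auto
    moreover have "card (A \<union> ({u} \<times> insert u ?cv \<union> ?cv \<times> {u})) =
        card A + card ({u} \<times> insert u ?cv \<union> ?cv \<times> {u})"
      using fA fc by (intro card_Un_disjoint) (auto simp: A_def)
    ultimately show ?thesis by simp
  qed
  also have "\<dots> \<le> card (equiv_pairs r ?G)"
  proof (intro card_mono finite_equiv_pairs rgraph_symmetrize[OF G uv])
    have "A \<subseteq> equiv_pairs r ?G"
      using keep by (auto simp: A_def equiv_pairs_def)
    moreover have "link r ?G y = link r ?G u" "y \<in> verts G" if "y \<in> ?cv" for y
    proof -
      show "y \<in> verts G" using that by (simp add: twins_def)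
      have "link r ?G y = link r ?G v"
        using that ucv uV by (intro keep) (auto simp: twins_def)
      then show "link r ?G y = link r ?G u" using link_symmetrize_eq[OF G uv] by simp
    qed
    ultimately show "A \<union> ({u} \<times> insert u ?cv \<union> ?cv \<times> {u}) \<subseteq> equiv_pairs r ?G"
      using uV by (auto simp: equiv_pairs_def)
  qed
  finally show ?thesis .
qed

text \<open>
  The number of equivalent pairs breaks ties between graphs with the same value of \<open>\<Gamma>\<close>; there are
  finitely many graphs on a given vertex set.
\<close>
lemma symmetrization_induct [consumes 3, case_names symmetrized step]:
  assumes "symmetrization_increasing r \<Gamma>" "1 \<le> r" "rgraph r G"
    and base: "\<And>H. \<lbrakk>rgraph r H; verts H = verts G; \<Gamma> G \<le> \<Gamma> H; symmetrized r H\<rbrakk> \<Longrightarrow> P H"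
    and step: "\<And>H u v. \<lbrakk>rgraph r H; verts H = verts G; \<Gamma> G \<le> \<Gamma> H; uncovered H u v;
       \<Gamma> H \<le> \<Gamma> (symmetrize r H u v); P (symmetrize r H u v)\<rbrakk> \<Longrightarrow> P H"
  shows "P G"
proof -
  \<comment> \<open>Comparison is by \<open>\<Gamma>\<close> first and by equivalent pairs second.
    The induction is on the number of graphs that beat \<open>H\<close>, so its hypothesis covers
    every better graph.\<close>
  define better where "better H' H \<longleftrightarrow> rgraph r H' \<and> verts H' = verts G \<and>
    (\<Gamma> H < \<Gamma> H' \<or> \<Gamma> H = \<Gamma> H' \<and> card (equiv_pairs r H) < card (equiv_pairs r H'))" for H' H
  have fin: "finite {H'. better H' H}" for H
  proof (rule finite_subset)
    show "{H'. better H' H} \<subseteq> {verts G} \<times> Pow (Pow (verts G))"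
      unfolding better_def rgraph_def by (intro subsetI) (simp add: mem_Times_iff, blast)
    show "finite ({verts G} \<times> Pow (Pow (verts G)))"
      using assms(3) by (simp add: rgraph_def)
  qed
  have "P H" if "rgraph r H" "verts H = verts G" "\<Gamma> G \<le> \<Gamma> H" for H
    using that
  proof (induction "card {H'. better H' H}" arbitrary: H rule: less_induct)
    case less
    have reduce: "P H" if uv: "uncovered H u v" and b: "better (symmetrize r H u v) H" for u v
    proof -
      let ?H = "symmetrize r H u v"
      have ge: "\<Gamma> H \<le> \<Gamma> ?H" using b by (auto simp: better_def)
      \<comment> \<open>By transitivity whatever beats \<open>?H\<close> beats \<open>H\<close>, and
        \<open>?H\<close> beats \<open>H\<close> but not itself: the set of better graphs shrinks
        strictly.\<close>
      have "better H' H" if "better H' ?H" for H'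
        using that b by (auto simp: better_def)
      moreover have "\<not> better ?H ?H" by (simp add: better_def)
      ultimately have "{H'. better H' ?H} \<subset> {H'. better H' H}"
        using b by blast
      then have "card {H'. better H' ?H} < card {H'. better H' H}"
        using fin by (intro psubset_card_mono)
      then have "P ?H"
        using less.prems b ge by (intro less.hyps) (auto simp: better_def)
      then show "P H" using step less.prems uv ge by blast
    qed
    show "P H"
    proof (cases "symmetrized r H")
      case True
      then show ?thesis using base less.prems by blast
    next
      case False
      then obtain u v where uv: "uncovered H u v" and ne: "link r H u \<noteq> link r H v"
        by (auto simp: symmetrized_def)
      have vu: "uncovered H v u" using uv uncovered_commute by metis
      note rg = rgraph_symmetrize[OF less.prems(1) assms(2)]
      consider "\<Gamma> H < \<Gamma> (symmetrize r H u v)" | "\<Gamma> H < \<Gamma> (symmetrize r H v u)"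
        | "\<Gamma> H = \<Gamma> (symmetrize r H u v)" "\<Gamma> H = \<Gamma> (symmetrize r H v u)"
        using assms(1) less.prems(1) uv unfolding symmetrization_increasing_def less_max_iff_disj by blast
      then show ?thesis
      proof cases
        case 1
        then show ?thesis
          using reduce[OF uv] rg[OF uv] less.prems by (simp add: better_def)
      next
        case 2
        then show ?thesis
          using reduce[OF vu] rg[OF vu] less.prems by (simp add: better_def)
      next
        case 3
        \<comment> \<open>In a tie both directions preserve \<open>\<Gamma>\<close>, so the vertex
          with the smaller class can be chosen as the one that moves.\<close>
        show ?thesis
        proof (cases "card (twins r H u) \<le> card (twins r H v)")
          case True
          then show ?thesis
            using reduce[OF uv] rg[OF uv] less.prems 3(1) ne
              card_equiv_pairs_symmetrize[OF less.prems(1) assms(2) uv]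
            by (simp add: better_def)
        next
          case False
          then show ?thesis
            using reduce[OF vu] rg[OF vu] less.prems 3(2) ne
              card_equiv_pairs_symmetrize[OF less.prems(1) assms(2) vu]
            by (simp add: better_def)
        qed
      qed
    qed
  qed
  then show ?thesis using assms(3) by simp
qed

section \<open>Extremal numbers and degrees\<close>

lemma ex_num_upper: "has_extremal r \<Gamma> \<Longrightarrow> G \<in> rgraphs r n \<Longrightarrow> \<Gamma> G \<le> ex_num r \<Gamma> n"
  unfolding ex_num_def has_extremal_def bdd_above_def by (intro cSUP_upper) (auto simp: bdd_above_def)

lemma ex_num_attained:
  assumes "has_extremal r \<Gamma>"
  obtains G where "G \<in> rgraphs r n" "\<Gamma> G = ex_num r \<Gamma> n"
proof -
  obtain G where G: "G \<in> rgraphs r n" "\<forall>H\<in>rgraphs r n. \<Gamma> H \<le> \<Gamma> G"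
    using assms unfolding has_extremal_def by blast
  then have "ex_num r \<Gamma> n \<le> \<Gamma> G"
    unfolding ex_num_def by (intro cSUP_least) auto
  then show ?thesis
    using that G(1) ex_num_upper[OF assms G(1)] by fastforce
qed

section \<open>Deletion of vertices of low degree\<close>

lemma locally_monotone_induced:
  assumes "locally_monotone r \<Gamma>" "rgraph r G" "\<Gamma> G > 0" "S \<subseteq> verts G" "v \<in> S"
  shows "gdeg \<Gamma> (induced G S) v \<le> gdeg \<Gamma> G v"
proof -
  have "v \<in> verts (induced G S)" using assms(5) by simp
  then show ?thesis
    using assms rgraph_induced subgraph_induced unfolding locally_monotone_def by blast
qed

lemma min_gdeg_ge_iff:
  "finite (verts G) \<Longrightarrow> verts G \<noteq> {} \<Longrightarrow> c \<le> min_gdeg \<Gamma> G \<longleftrightarrow> (\<forall>v\<in>verts G. c \<le> gdeg \<Gamma> G v)"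
  by (simp add: min_gdeg_def)

text \<open>The vertices are deleted one at a time. By local monotonicity a vertex has no larger
  degree in what remains than in \<open>G\<close>, so each deletion costs at most
  \<open>d\<close>.\<close>

lemma remove_low_degree:
  assumes "locally_monotone r \<Gamma>" "rgraph r G" "\<Gamma> G > 0" "Z \<subseteq> verts G"
    and "\<And>v. v \<in> Z \<Longrightarrow> gdeg \<Gamma> G v \<le> d"
  shows "\<Gamma> G - real (card Z) * d \<le> \<Gamma> (induced G (verts G - Z))"
proof -
  have "finite Z" using assms by (auto simp: rgraph_def intro: finite_subset)
  then show ?thesis using assms(4,5)
  proof (induction Z)
    case empty
    then show ?case using assms(2) by (simp add: induced_verts)
  next
    case (insert v Z)
    let ?H = "induced G (verts G - Z)"
    have "gdeg \<Gamma> ?H v \<le> gdeg \<Gamma> G v"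
      using insert.prems insert.hyps by (intro locally_monotone_induced[OF assms(1-3)]) auto
    then have "gdeg \<Gamma> ?H v \<le> d" using insert.prems(2)[of v] by simp
    moreover have "delete_vertex ?H v = induced G (verts G - insert v Z)"
      by (metis Diff_insert delete_vertex_induced)
    ultimately have "\<Gamma> ?H - d \<le> \<Gamma> (induced G (verts G - insert v Z))"
      by (simp add: gdeg_def)
    moreover have "\<Gamma> G - real (card Z) * d \<le> \<Gamma> ?H" using insert by auto
    ultimately show ?case using insert.hyps by (simp add: algebra_simps)
  qed
qed

text \<open>Otherwise deleting exactly \<open>p\<close> of these vertices would leave a graph on
  \<open>n - p\<close> vertices whose value exceeds the extremal number.\<close>

lemma card_low_degree_less:
  assumes "has_extremal r \<Gamma>" "locally_monotone r \<Gamma>" "G \<in> rgraphs r n" "\<Gamma> G > 0" "Z \<subseteq> verts G"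
    and "\<And>v. v \<in> Z \<Longrightarrow> gdeg \<Gamma> G v \<le> d"
    and "ex_num r \<Gamma> (n - p) < \<Gamma> G - real p * d"
  shows "card Z < p"
proof (rule ccontr)
  assume "\<not> card Z < p"
  then obtain Y where Y: "Y \<subseteq> Z" "card Y = p"
    using obtain_subset_with_card_n by (metis not_less)
  have G: "rgraph r G" "card (verts G) = n" "finite (verts G)"
    using assms(3) by (auto simp: rgraphs_def rgraph_def)
  have "finite Y" using Y assms(5) G by (meson finite_subset)
  then have "card (verts G - Y) = n - p"
    using Y assms(5) G by (simp add: card_Diff_subset)
  then have "induced G (verts G - Y) \<in> rgraphs r (n - p)"
    using rgraph_induced[OF G(1)] by (simp add: rgraphs_def)
  then have "\<Gamma> (induced G (verts G - Y)) \<le> ex_num r \<Gamma> (n - p)"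
    by (rule ex_num_upper[OF assms(1)])
  moreover have "\<Gamma> G - real (card Y) * d \<le> \<Gamma> (induced G (verts G - Y))"
    using assms Y G by (intro remove_low_degree[OF assms(2)]) auto
  ultimately show False using assms(7) Y by simp
qed

text \<open>
  For \<open>k < 0\<close> the Lipschitz condition would force degrees to increase in subgraphs, against local
  monotonicity.
\<close>
lemma uniformity_constant_pos:
  assumes nn: "\<forall>G. rgraph r G \<longrightarrow> \<Gamma> G \<ge> 0" and ext: "has_extremal r \<Gamma>"
    and nd: "nondegenerate r \<Gamma> k" and C: "C > 0"
    and lip: "locally_lipschitz r \<Gamma> k C" and mono: "locally_monotone r \<Gamma>"
  shows "k > 0"
proof (rule ccontr)
  assume "\<not> k > 0"
  then have k: "k \<le> 0" by simp
  obtain f where f: "f \<in> o(\<lambda>n. exdeg r \<Gamma> k n)"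
    and lipf: "\<forall>n. \<forall>G\<in>rgraphs r n. \<Gamma> G > 0 \<longrightarrow> (\<forall>S\<subseteq>verts G. \<forall>v\<in>S. gdeg \<Gamma> (induced G S) v
      \<ge> gdeg \<Gamma> G v - C * (real n - real (card S)) / real n * exdeg r \<Gamma> k n - f n)"
    using lip unfolding locally_lipschitz_def by (rule bexE)
  have "\<forall>\<^sub>F n in sequentially. \<bar>f n\<bar> \<le> C / 4 * \<bar>exdeg r \<Gamma> k n\<bar>"
    using landau_o.smallD[OF f, of "C / 4"] C by simp
  then have "\<forall>\<^sub>F n in sequentially.
      exdeg r \<Gamma> k n \<noteq> 0 \<and> \<bar>f n\<bar> \<le> C / 4 * \<bar>exdeg r \<Gamma> k n\<bar> \<and> n \<ge> 2"
    using nd unfolding nondegenerate_def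
    by (intro eventually_conj eventually_ge_at_top)
  then obtain n where n: "exdeg r \<Gamma> k n \<noteq> 0" "\<bar>f n\<bar> \<le> C / 4 * \<bar>exdeg r \<Gamma> k n\<bar>" "n \<ge> 2"
    unfolding eventually_sequentially by blast
  obtain G where G: "G \<in> rgraphs r n" "\<Gamma> G = ex_num r \<Gamma> n" using ex_num_attained[OF ext] .
  have rg: "rgraph r G" "card (verts G) = n" using G by (auto simp: rgraphs_def)
  have pos: "\<Gamma> G > 0"
  proof -
    have "\<Gamma> G \<ge> 0" using nn rg by blast
    moreover have "\<Gamma> G \<noteq> 0" using G n(1) by (auto simp: exdeg_def)
    ultimately show ?thesis by simp
  qed
  have neg: "exdeg r \<Gamma> k n < 0"
  proof -
    have "exdeg r \<Gamma> k n \<le> 0"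
      unfolding exdeg_def using k pos G(2)
      by (intro divide_nonpos_nonneg mult_nonpos_nonneg) auto
    then show ?thesis using n(1) by simp
  qed
  obtain v where v: "v \<in> verts G" using rg n(3) by fastforce
  \<comment> \<open>Shrinking to the single vertex \<open>v\<close> removes \<open>n - 1\<close>
    vertices. With negative \<open>exdeg\<close> the Lipschitz term is a gain of at least half of
    \<open>C * \<bar>exdeg\<bar>\<close> for \<open>n \<ge> 2\<close>, which beats the error of a
    quarter.\<close>
  have "gdeg \<Gamma> (induced G {v}) v \<le> gdeg \<Gamma> G v"
    using v by (intro locally_monotone_induced[OF mono rg(1) pos]) auto
  moreover have "gdeg \<Gamma> (induced G {v}) v \<ge> gdeg \<Gamma> G v - C * (real n - 1) / real n * exdeg r \<Gamma> k n - f n"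
    using lipf[rule_format, OF G(1) pos, of "{v}" v] v by simp
  ultimately have "C * (real n - 1) / real n * - exdeg r \<Gamma> k n \<le> C / 4 * - exdeg r \<Gamma> k n"
    using n(2) neg by auto
  then have "C * (real n - 1) / real n \<le> C / 4"
    by (rule mult_right_le_imp_le) (use neg in simp)
  then have "C * (4 * (real n - 1)) \<le> C * real n" using n(3) by (simp add: field_simps)
  then have "4 * (real n - 1) \<le> real n" using C by simp
  then show False using n(3) by simp
qed

lemma eventually_ex_num_pos:
  assumes "\<forall>G. rgraph r G \<longrightarrow> \<Gamma> G \<ge> 0" "has_extremal r \<Gamma>" "nondegenerate r \<Gamma> k"
  shows "\<forall>\<^sub>F n in sequentially. 0 < n \<and> 0 < ex_num r \<Gamma> n"
  using assms(3) unfolding nondegenerate_def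
proof (rule eventually_mono)
  fix n assume n: "exdeg r \<Gamma> k n \<noteq> 0"
  obtain G where G: "G \<in> rgraphs r n" "\<Gamma> G = ex_num r \<Gamma> n" using ex_num_attained[OF assms(2)] .
  then have "rgraph r G" by (simp add: rgraphs_def)
  then have "ex_num r \<Gamma> n \<ge> 0" using assms(1) G(2) by metis
  \<comment> \<open>Division by zero yields 0, so \<open>exdeg\<close> vanishes at
    \<open>n = 0\<close>.\<close>
  moreover have "ex_num r \<Gamma> n \<noteq> 0" "n \<noteq> 0" using n by (auto simp: exdeg_def)
  ultimately show "0 < n \<and> 0 < ex_num r \<Gamma> n" by simp
qed

section \<open>Degree stability\<close>

lemma powr_one_plus_le:
  fixes d c :: real
  assumes "0 \<le> d" "d \<le> 1" "0 < c"
  shows "d powr (1 + c) \<le> d"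
proof (cases "d = 0")
  case False
  then have "d powr (1 + c) \<le> d powr 1" using assms by (intro powr_mono') auto
  then show ?thesis using assms False by simp
qed simp

text \<open>
  Deleting \<open>\<delta>n\<close> low-degree vertices costs at most \<open>\<delta>(1 - \<epsilon>) k ex(n)\<close>, so by smoothness
  \<open>\<delta>k\<epsilon> \<le> \<eta> + C\<^sub>*\<delta>\<^sup>1\<^sup>+\<^sup>c + o(1)\<close>, which is false for \<open>\<delta>\<close> small and \<open>\<eta>\<close> smaller.
\<close>
lemma few_low_degree_vertices:
  assumes nn: "\<forall>G. rgraph r G \<longrightarrow> \<Gamma> G \<ge> 0" and ex: "has_extremal r \<Gamma>"
    and nd: "nondegenerate r \<Gamma> k" and mono: "locally_monotone r \<Gamma>"
    and sm: "smooth r \<Gamma> k \<delta>s cs Cs" and pos: "0 < \<delta>s" "\<delta>s \<le> 1" "0 < cs" "0 < Cs" "0 < k"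
    and \<epsilon>: "0 < \<epsilon>" and \<sigma>: "0 < \<sigma>"
  shows "\<exists>\<eta>. 0 < \<eta> \<and> \<eta> < 1 \<and> (\<forall>\<^sub>F n in sequentially. \<forall>G\<in>rgraphs r n.
    (1 - \<eta>) * ex_num r \<Gamma> n \<le> \<Gamma> G \<longrightarrow>
    real (card {v \<in> verts G. gdeg \<Gamma> G v < (1 - \<epsilon>) * exdeg r \<Gamma> k n}) \<le> \<sigma> * real n)"
proof -
  obtain f where f: "f \<in> o(\<lambda>n. ex_num r \<Gamma> n)"
    and smf: "\<forall>n m. \<forall>\<delta>\<in>{0..\<delta>s}. real m = real n - \<delta> * real n \<longrightarrow>
        ex_num r \<Gamma> m \<le> ex_num r \<Gamma> n - \<delta> * k * ex_num r \<Gamma> n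
                        + Cs * \<delta> powr (1 + cs) * ex_num r \<Gamma> n + f n"
    using sm unfolding smooth_def by (rule bexE)
  \<comment> \<open>For \<open>\<delta> \<le> \<beta>\<close> the last bound limits the smoothness
    error to a quarter of \<open>\<delta> * k * \<epsilon>\<close>; the other two bounds make
    smoothness applicable and give the conclusion. The loss \<open>\<eta>\<close> occurs twice, in
    the error term and in near extremality; since \<open>\<delta> \<ge> \<beta> / 2\<close>, the
    choice of \<open>\<eta>\<close> keeps \<open>2 * \<eta>\<close> within half of
    \<open>\<delta> * k * \<epsilon>\<close>.\<close>
  define \<beta> where "\<beta> = min (min \<delta>s \<sigma>) ((k * \<epsilon> / (4 * Cs)) powr (1 / cs))"
  define \<eta> where "\<eta> = min (\<beta> * k * \<epsilon> / 8) (1/2)"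
  have base: "k * \<epsilon> / (4 * Cs) > 0" using pos \<epsilon> by simp
  then have \<beta>: "0 < \<beta>" "\<beta> \<le> \<delta>s" "\<beta> \<le> \<sigma>" "\<beta> \<le> (k * \<epsilon> / (4 * Cs)) powr (1 / cs)"
    using pos \<epsilon> \<sigma> by (auto simp: \<beta>_def)
  have "\<beta> powr cs \<le> ((k * \<epsilon> / (4 * Cs)) powr (1 / cs)) powr cs"
    using \<beta> pos by (intro powr_mono2) auto
  also have "\<dots> = k * \<epsilon> / (4 * Cs)" using base pos \<epsilon> by (simp add: powr_powr)
  finally have \<beta>cs: "\<beta> powr cs \<le> k * \<epsilon> / (4 * Cs)" .
  have \<eta>: "0 < \<eta>" "\<eta> < 1" "\<eta> \<le> \<beta> * k * \<epsilon> / 8" using \<beta> pos \<epsilon> by (auto simp: \<eta>_def)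
  have few: "real (card {v \<in> verts G. gdeg \<Gamma> G v < (1 - \<epsilon>) * exdeg r \<Gamma> k n}) \<le> \<sigma> * real n"
    if n: "0 < n" "0 < ex_num r \<Gamma> n" "\<bar>f n\<bar> \<le> \<eta> * \<bar>ex_num r \<Gamma> n\<bar>" "2 / \<beta> \<le> real n"
      and G: "G \<in> rgraphs r n" and large: "(1 - \<eta>) * ex_num r \<Gamma> n \<le> \<Gamma> G" for n G
  proof -
    let ?E = "ex_num r \<Gamma> n" and ?D = "exdeg r \<Gamma> k n"
    let ?Z = "{v \<in> verts G. gdeg \<Gamma> G v < (1 - \<epsilon>) * ?D}"
    \<comment> \<open>Here \<open>p\<close> is the number of vertices to delete. Rounding up leaves
      \<open>\<delta>\<close> between \<open>\<beta> / 2\<close> and \<open>\<beta>\<close> once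
      \<open>\<beta> * n \<ge> 2\<close>.\<close>
    define p where "p = nat \<lceil>\<beta> / 2 * real n\<rceil>"
    define \<delta> where "\<delta> = real p / real n"
    have n2: "2 \<le> \<beta> * real n" using n(4) \<beta>(1) by (simp add: field_simps)
    have p: "\<beta> / 2 * real n \<le> real p" "real p \<le> \<beta> / 2 * real n + 1"
      unfolding p_def using n2 by linarith+
    then have "real p \<le> \<beta> * real n" using n2 by simp
    then have \<delta>: "\<beta> / 2 \<le> \<delta>" "\<delta> \<le> \<beta>" using p(1) n(1) by (auto simp: \<delta>_def field_simps)
    have "\<beta> * real n \<le> 1 * real n" using \<beta> pos by (intro mult_right_mono) auto
    then have "p \<le> n" using \<open>real p \<le> \<beta> * real n\<close> by linarith
    have "real (n - p) = real n - \<delta> * real n" using \<open>p \<le> n\<close> n(1) by (simp add: \<delta>_def)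
    then have "ex_num r \<Gamma> (n - p) \<le> ?E - \<delta> * k * ?E + Cs * \<delta> powr (1 + cs) * ?E + f n"
      using smf \<delta> \<beta> by auto
    also have "\<dots> \<le> ?E - \<delta> * k * ?E + \<delta> * (k * \<epsilon>) / 4 * ?E + \<eta> * ?E"
    proof -
      have "\<delta> powr cs \<le> \<beta> powr cs" using \<delta> \<beta> pos by (intro powr_mono2) auto
      then have "\<delta> powr cs \<le> k * \<epsilon> / (4 * Cs)" using \<beta>cs by simp
      then have "Cs * \<delta> * \<delta> powr cs \<le> Cs * \<delta> * (k * \<epsilon> / (4 * Cs))"
        using pos \<delta> \<beta> by (intro mult_left_mono) auto
      then have "Cs * \<delta> powr (1 + cs) \<le> \<delta> * (k * \<epsilon>) / 4"
        using \<delta> \<beta> pos by (simp add: powr_add field_simps)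
      then have "Cs * \<delta> powr (1 + cs) * ?E \<le> \<delta> * (k * \<epsilon>) / 4 * ?E"
        using n(2) by (intro mult_right_mono) auto
      moreover have "f n \<le> \<eta> * ?E" using n(2,3) by simp
      ultimately show ?thesis by linarith
    qed
    also have "\<dots> < (1 - \<eta>) * ?E - \<delta> * ((1 - \<epsilon>) * k) * ?E"
    proof -
      have "\<beta> / 2 * (k * \<epsilon>) \<le> \<delta> * (k * \<epsilon>)" using \<delta> pos \<epsilon> by (intro mult_right_mono) auto
      moreover have "0 < \<beta> * (k * \<epsilon>)" using \<beta> pos \<epsilon> by simp
      ultimately have "0 < 3 / 4 * (\<delta> * (k * \<epsilon>)) - 2 * \<eta>" using \<eta>(3) by (simp add: algebra_simps)
      then have "0 < (3 / 4 * (\<delta> * (k * \<epsilon>)) - 2 * \<eta>) * ?E" using n(2) by simp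
      then show ?thesis by (simp add: algebra_simps)
    qed
    also have "\<dots> = (1 - \<eta>) * ?E - real p * ((1 - \<epsilon>) * ?D)"
      by (simp add: exdeg_def \<delta>_def)
    also have "\<dots> \<le> \<Gamma> G - real p * ((1 - \<epsilon>) * ?D)" using large by simp
    finally have less: "ex_num r \<Gamma> (n - p) < \<Gamma> G - real p * ((1 - \<epsilon>) * ?D)" .
    have "0 < (1 - \<eta>) * ?E" using \<eta> n(2) by simp
    then have "0 < \<Gamma> G" using large by linarith
    then have "card ?Z < p"
      by (intro card_low_degree_less[OF ex mono G _ _ _ less]) auto
    then have "real (card ?Z) \<le> \<beta> * real n" using \<open>real p \<le> \<beta> * real n\<close> by linarith
    also have "\<dots> \<le> \<sigma> * real n" using \<beta> by (intro mult_right_mono) auto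
    finally show ?thesis .
  qed
  have "\<forall>\<^sub>F n in sequentially. \<bar>f n\<bar> \<le> \<eta> * \<bar>ex_num r \<Gamma> n\<bar>"
    using landau_o.smallD[OF f \<eta>(1)] by simp
  moreover have "\<forall>\<^sub>F n in sequentially. 2 / \<beta> \<le> real n"
    using eventually_ge_at_top[of "nat \<lceil>2 / \<beta>\<rceil>"] by eventually_elim linarith
  ultimately have "\<forall>\<^sub>F n in sequentially. \<forall>G\<in>rgraphs r n.
    (1 - \<eta>) * ex_num r \<Gamma> n \<le> \<Gamma> G \<longrightarrow>
    real (card {v \<in> verts G. gdeg \<Gamma> G v < (1 - \<epsilon>) * exdeg r \<Gamma> k n}) \<le> \<sigma> * real n"
    using eventually_ex_num_pos[OF nn ex nd]
    by eventually_elim (use few in blast)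
  then show ?thesis using \<eta> by blast
qed

text \<open>
  By the Lipschitz condition, deleting few vertices hardly changes the degrees of the others, and by
  smoothness it hardly changes the extremal degree.
\<close>
lemma vertex_extendable_induced:
  assumes nn: "\<forall>G. rgraph r G \<longrightarrow> \<Gamma> G \<ge> 0" and ex: "has_extremal r \<Gamma>"
    and nd: "nondegenerate r \<Gamma> k"
    and sm: "smooth r \<Gamma> k \<delta>s cs Cs" and pos: "0 < \<delta>s" "\<delta>s \<le> 1" "0 < cs" "0 < Cs" "0 < k" "0 < C"
    and lip: "locally_lipschitz r \<Gamma> k C" and ve: "vertex_extendable r \<Gamma> k \<HH>"
  shows "\<exists>\<epsilon>>0. \<exists>\<sigma>>0. \<forall>\<^sub>F n in sequentially. \<forall>G\<in>rgraphs r n. \<forall>S\<subseteq>verts G. \<forall>v\<in>S.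
    0 < \<Gamma> G \<and> (\<forall>w\<in>S. (1 - \<epsilon>) * exdeg r \<Gamma> k n \<le> gdeg \<Gamma> G w) \<and>
    real n - real (card S) \<le> \<sigma> * real n \<and> induced G (S - {v}) \<in> \<HH> \<longrightarrow> induced G S \<in> \<HH>"
proof -
  obtain f where f: "f \<in> o(\<lambda>n. ex_num r \<Gamma> n)"
    and smf: "\<forall>n m. \<forall>\<delta>\<in>{0..\<delta>s}. real m = real n - \<delta> * real n \<longrightarrow>
        ex_num r \<Gamma> m \<le> ex_num r \<Gamma> n - \<delta> * k * ex_num r \<Gamma> n
                        + Cs * \<delta> powr (1 + cs) * ex_num r \<Gamma> n + f n"
    using sm unfolding smooth_def by (rule bexE)
  obtain g where g: "g \<in> o(\<lambda>n. exdeg r \<Gamma> k n)"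
    and lipg: "\<forall>n. \<forall>G\<in>rgraphs r n. \<Gamma> G > 0 \<longrightarrow> (\<forall>S\<subseteq>verts G. \<forall>v\<in>S. gdeg \<Gamma> (induced G S) v
      \<ge> gdeg \<Gamma> G v - C * (real n - real (card S)) / real n * exdeg r \<Gamma> k n - g n)"
    using lip unfolding locally_lipschitz_def by (rule bexE)
  obtain \<epsilon>x N where \<epsilon>x: "\<epsilon>x > 0"
    and vex: "\<forall>n\<ge>N. \<forall>G\<in>rgraphs r n. min_gdeg \<Gamma> G \<ge> (1 - \<epsilon>x) * exdeg r \<Gamma> k n \<and>
        (\<exists>v\<in>verts G. delete_vertex G v \<in> \<HH>) \<longrightarrow> G \<in> \<HH>"
    using ve unfolding vertex_extendable_def by blast
  \<comment> \<open>Capping at 1 keeps \<open>1 - e\<close> nonnegative, so that an upper bound for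
    \<open>exdeg\<close> at \<open>card S\<close> can be multiplied by it.\<close>
  define e where "e = min \<epsilon>x 1"
  \<comment> \<open>The bounds serve, in order: smoothness at
    \<open>\<delta> \<le> \<sigma>\<close>; \<open>card S \<ge> n / 2 \<ge> N\<close>; and a total
    loss of at most \<open>e / 4\<close> from the terms linear in \<open>\<sigma>\<close>.\<close>
  define \<sigma> where "\<sigma> = min (min \<delta>s (1/2)) (e / (4 * (C + 1 + Cs)))"
  define \<tau> where "\<tau> = e / 8"
  have e: "0 < e" "e \<le> \<epsilon>x" "e \<le> 1" using \<epsilon>x by (auto simp: e_def)
  have \<sigma>: "0 < \<sigma>" "\<sigma> \<le> \<delta>s" "\<sigma> \<le> 1/2" "\<sigma> \<le> e / (4 * (C + 1 + Cs))"
  proof -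
    have "0 < e / (4 * (C + 1 + Cs))" using pos e by simp
    then show "0 < \<sigma>" "\<sigma> \<le> \<delta>s" "\<sigma> \<le> 1/2" "\<sigma> \<le> e / (4 * (C + 1 + Cs))"
      using pos unfolding \<sigma>_def by linarith+
  qed
  have \<sigma>e: "C * \<sigma> + \<sigma> + Cs * \<sigma> \<le> e / 4"
  proof -
    have "\<sigma> * (4 * (C + 1 + Cs)) \<le> e" using \<sigma>(4) pos by (subst (asm) pos_le_divide_eq) auto
    then show ?thesis by (simp add: algebra_simps)
  qed
  have \<tau>: "0 < \<tau>" using e by (simp add: \<tau>_def)
  \<comment> \<open>On the right, \<open>e / 4\<close> is the assumed degree deficit and
    \<open>C * \<sigma> + \<tau>\<close> the Lipschitz loss. The factor
    \<open>1 + Cs * \<sigma> + \<tau>\<close> bounds the growth of \<open>ex_num\<close>, and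
    \<open>1 - \<sigma>\<close> comes from dividing by \<open>card S\<close> instead of
    \<open>n\<close>.\<close>
  have ineq: "(1 - e) * (1 + Cs * \<sigma> + \<tau>) \<le> (1 - e / 4 - C * \<sigma> - \<tau>) * (1 - \<sigma>)"
  proof -
    have "0 \<le> e * (Cs * \<sigma> + \<tau>)" using e \<sigma> pos \<tau> by simp
    moreover have "(1 - e) * (1 + Cs * \<sigma> + \<tau>) = 1 - e + Cs * \<sigma> + \<tau> - e * (Cs * \<sigma> + \<tau>)"
      by (simp add: algebra_simps)
    ultimately have "(1 - e) * (1 + Cs * \<sigma> + \<tau>) \<le> 1 - e + Cs * \<sigma> + \<tau>" by simp
    also have "\<dots> \<le> 1 - e / 4 - C * \<sigma> - \<tau> - \<sigma>"
      using \<sigma>e e(1) unfolding \<tau>_def by linarith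
    also have "\<dots> \<le> (1 - e / 4 - C * \<sigma> - \<tau>) * (1 - \<sigma>)"
    proof -
      have "0 \<le> \<sigma> * (e / 4 + C * \<sigma> + \<tau>)" using e \<sigma> pos \<tau> by simp
      moreover have "(1 - e / 4 - C * \<sigma> - \<tau>) * (1 - \<sigma>) =
          1 - e / 4 - C * \<sigma> - \<tau> - \<sigma> + \<sigma> * (e / 4 + C * \<sigma> + \<tau>)"
        by (simp add: field_simps)
      ultimately show ?thesis by simp
    qed
    finally show ?thesis .
  qed
  have main: "induced G S \<in> \<HH>"
    if n: "0 < n" "0 < ex_num r \<Gamma> n" "\<bar>f n\<bar> \<le> \<tau> * \<bar>ex_num r \<Gamma> n\<bar>"
        "\<bar>g n\<bar> \<le> \<tau> * \<bar>exdeg r \<Gamma> k n\<bar>" "2 * N \<le> n"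
      and G: "G \<in> rgraphs r n" "0 < \<Gamma> G" and S: "S \<subseteq> verts G" "v \<in> S"
      and deg: "\<forall>w\<in>S. (1 - e / 4) * exdeg r \<Gamma> k n \<le> gdeg \<Gamma> G w"
      and card: "real n - real (card S) \<le> \<sigma> * real n" and del: "induced G (S - {v}) \<in> \<HH>"
    for n G S v
  proof -
    let ?E = "ex_num r \<Gamma> n" and ?D = "exdeg r \<Gamma> k n" and ?m = "card S"
    define \<delta> where "\<delta> = (real n - real ?m) / real n"
    have rG: "rgraph r G" "finite (verts G)" "card (verts G) = n"
      using G by (auto simp: rgraphs_def rgraph_def)
    have D: "0 < ?D" using n pos by (simp add: exdeg_def)
    have "?m \<le> n" using card_mono[OF rG(2) S(1)] rG(3) by simp
    then have \<delta>: "0 \<le> \<delta>" "\<delta> \<le> \<sigma>" using card n(1) by (auto simp: \<delta>_def field_simps)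
    have mge: "(1 - \<sigma>) * real n \<le> real ?m" using card by (simp add: algebra_simps)
    moreover have "1 / 2 * real n \<le> (1 - \<sigma>) * real n" using \<sigma> by (intro mult_right_mono) auto
    ultimately have "N \<le> ?m" using n(5) by linarith
    have "0 < (1 - \<sigma>) * real n" using \<sigma> n(1) by simp
    have "real ?m = real n - \<delta> * real n" using n(1) by (simp add: \<delta>_def)
    then have "ex_num r \<Gamma> ?m \<le> ?E - \<delta> * k * ?E + Cs * \<delta> powr (1 + cs) * ?E + f n"
      using smf \<delta> \<sigma> by auto
    \<comment> \<open>The decrease \<open>\<delta> * k * ?E\<close> is dropped: here smoothness only
      has to show that the smaller extremal number is not much larger.\<close>
    also have "\<dots> \<le> (1 + Cs * \<sigma> + \<tau>) * ?E"
    proof -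
      have "\<delta> powr (1 + cs) \<le> \<sigma>"
        using powr_one_plus_le[of \<delta> cs] \<delta> \<sigma> pos by simp
      then have "Cs * \<delta> powr (1 + cs) * ?E \<le> Cs * \<sigma> * ?E"
        using pos n(2) by (intro mult_right_mono mult_left_mono) auto
      moreover have "0 \<le> \<delta> * k * ?E" using \<delta> pos n(2) by simp
      moreover have "f n \<le> \<tau> * ?E" using n(2,3) by simp
      ultimately show ?thesis unfolding distrib_right mult_1 by linarith
    qed
    finally have exm: "ex_num r \<Gamma> ?m \<le> (1 + Cs * \<sigma> + \<tau>) * ?E" .
    have "(1 - \<epsilon>x) * exdeg r \<Gamma> k ?m \<le> (1 - e) * exdeg r \<Gamma> k ?m"
    proof -
      obtain K where K: "K \<in> rgraphs r ?m" "\<Gamma> K = ex_num r \<Gamma> ?m" using ex_num_attained[OF ex] .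
      then have "rgraph r K" by (simp add: rgraphs_def)
      then have "0 \<le> ex_num r \<Gamma> ?m" using nn K(2) by metis
      then have "0 \<le> exdeg r \<Gamma> k ?m" using pos by (simp add: exdeg_def)
      then show ?thesis using e by (intro mult_right_mono) auto
    qed
    also have "\<dots> \<le> (1 - e) * ((1 + Cs * \<sigma> + \<tau>) * ?D / (1 - \<sigma>))"
    proof (intro mult_left_mono)
      have "exdeg r \<Gamma> k ?m \<le> k * ((1 + Cs * \<sigma> + \<tau>) * ?E) / ((1 - \<sigma>) * real n)"
        unfolding exdeg_def using exm mge pos n(2) \<sigma> \<tau> \<open>0 < (1 - \<sigma>) * real n\<close>
        by (intro frac_le mult_left_mono) auto
      then show "exdeg r \<Gamma> k ?m \<le> (1 + Cs * \<sigma> + \<tau>) * ?D / (1 - \<sigma>)"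
        by (simp add: exdeg_def mult_ac)
    qed (use e in simp)
    also have "\<dots> \<le> (1 - e / 4 - C * \<sigma> - \<tau>) * ?D"
    proof -
      have "(1 - e) * (1 + Cs * \<sigma> + \<tau>) * ?D \<le> (1 - e / 4 - C * \<sigma> - \<tau>) * (1 - \<sigma>) * ?D"
        using ineq D by (intro mult_right_mono) auto
      then show ?thesis using \<sigma> by (simp add: divide_le_eq mult_ac)
    qed
    finally have bound: "(1 - \<epsilon>x) * exdeg r \<Gamma> k ?m \<le> (1 - e / 4 - C * \<sigma> - \<tau>) * ?D" .
    have degS: "(1 - \<epsilon>x) * exdeg r \<Gamma> k ?m \<le> gdeg \<Gamma> (induced G S) w" if w: "w \<in> S" for w
    proof -
      have "gdeg \<Gamma> G w - C * \<delta> * ?D - g n \<le> gdeg \<Gamma> (induced G S) w"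
        using lipg[rule_format, OF G S(1) w] by (simp add: \<delta>_def)
      moreover have "C * \<delta> * ?D \<le> C * \<sigma> * ?D"
        using \<delta> pos D by (intro mult_right_mono mult_left_mono) auto
      moreover have "g n \<le> \<tau> * ?D" using n(4) D by simp
      moreover have "(1 - e / 4) * ?D \<le> gdeg \<Gamma> G w" using deg w by blast
      ultimately show ?thesis using bound by (simp add: algebra_simps)
    qed
    have "finite S" using S rG(2) finite_subset by blast
    have "(1 - \<epsilon>x) * exdeg r \<Gamma> k ?m \<le> min_gdeg \<Gamma> (induced G S)"
      using min_gdeg_ge_iff[of "induced G S"] \<open>finite S\<close> S(2) degS by auto
    moreover have "induced G S \<in> rgraphs r ?m"
      using rgraph_induced[OF rG(1) S(1)] by (simp add: rgraphs_def)
    moreover have "\<exists>v\<in>verts (induced G S). delete_vertex (induced G S) v \<in> \<HH>"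
      using del S(2) by (auto simp: delete_vertex_induced)
    ultimately show ?thesis using vex \<open>N \<le> ?m\<close> by blast
  qed
  have "\<forall>\<^sub>F n in sequentially. \<bar>f n\<bar> \<le> \<tau> * \<bar>ex_num r \<Gamma> n\<bar>"
    using landau_o.smallD[OF f \<tau>] by simp
  moreover have "\<forall>\<^sub>F n in sequentially. \<bar>g n\<bar> \<le> \<tau> * \<bar>exdeg r \<Gamma> k n\<bar>"
    using landau_o.smallD[OF g \<tau>] by simp
  ultimately have "\<forall>\<^sub>F n in sequentially. \<forall>G\<in>rgraphs r n. \<forall>S\<subseteq>verts G. \<forall>v\<in>S.
    0 < \<Gamma> G \<and> (\<forall>w\<in>S. (1 - e / 4) * exdeg r \<Gamma> k n \<le> gdeg \<Gamma> G w) \<and>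
    real n - real (card S) \<le> \<sigma> * real n \<and> induced G (S - {v}) \<in> \<HH> \<longrightarrow> induced G S \<in> \<HH>"
    using eventually_ex_num_pos[OF nn ex nd] eventually_ge_at_top[of "2 * N"]
    by eventually_elim (use main in blast)
  then show ?thesis using e \<sigma>(1) by (intro exI[of _ "e / 4"] exI[of _ \<sigma>] conjI) auto
qed

text \<open>
  Deleting the moved vertex \<open>u\<close> turns \<open>H\<close> and its symmetrization into the same graph, so membership
  in \<open>\<HH>\<close> passes back from the symmetrization to \<open>H\<close> by re-adding the few deleted vertices that are
  not low in \<open>H\<close>.
\<close>
lemma induced_minus_low_mem:
  assumes "symmetrization_increasing r \<Gamma>" "symmetrized_stable r \<Gamma> \<HH>" "hereditary r \<HH>" "1 \<le> r"
    and G: "G \<in> rgraphs r n" "0 < \<Gamma> G"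
    and few: "\<And>H. \<lbrakk>H \<in> rgraphs r n; \<Gamma> G \<le> \<Gamma> H\<rbrakk> \<Longrightarrow> real (card (low H)) \<le> b"
    and low: "\<And>H. low H \<subseteq> verts H"
    and ext: "\<And>H S v. \<lbrakk>H \<in> rgraphs r n; \<Gamma> G \<le> \<Gamma> H; S \<subseteq> verts H - low H; v \<in> S;
      real n - real (card S) \<le> 2 * b + 1; induced H (S - {v}) \<in> \<HH>\<rbrakk> \<Longrightarrow> induced H S \<in> \<HH>"
  shows "induced G (verts G - low G) \<in> \<HH>"
proof -
  have rG: "rgraph r G" "card (verts G) = n" "finite (verts G)"
    using G by (auto simp: rgraphs_def rgraph_def)
  show ?thesis using assms(1) \<open>1 \<le> r\<close> rG(1)
  proof (induction rule: symmetrization_induct)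
    case (symmetrized H)
    then have "H \<in> \<HH>" using assms(2) G(2) unfolding symmetrized_stable_def by fastforce
    then have "induced H (verts H) \<in> \<HH>" using symmetrized(1) by (simp add: induced_verts)
    then show ?case by (rule hereditary_induced[OF assms(3)]) auto
  next
    case (step H u v)
    let ?H = "symmetrize r H u v" and ?V = "verts G"
    have mem: "H \<in> rgraphs r n" "?H \<in> rgraphs r n"
      using step rgraph_symmetrize[OF step(1) \<open>1 \<le> r\<close> step(4)] rG(2) by (auto simp: rgraphs_def)
    \<comment> \<open>Avoiding \<open>u\<close> makes \<open>H\<close> and \<open>?H\<close> agree
      on \<open>S0\<close>; avoiding \<open>low ?H\<close> makes the induction hypothesis apply. At
      most \<open>2 * b + 1\<close> vertices are missing, the 1 being \<open>u\<close>.\<close>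
    define S0 where "S0 = ?V - (low H \<union> low ?H \<union> {u})"
    have "induced ?H S0 \<in> \<HH>"
      by (rule hereditary_induced[OF assms(3) step(6)]) (auto simp: S0_def step(2))
    then have S0: "induced H S0 \<in> \<HH>"
      using induced_symmetrize[of u S0 r H v] by (simp add: S0_def)
    have lowV: "low H \<subseteq> ?V" "low ?H \<subseteq> ?V" using low[of H] low[of ?H] step(2) by auto
    have u: "u \<in> ?V" using step(2,4) by (simp add: uncovered_def)
    have "card (low H \<union> low ?H \<union> {u}) \<le> card (low H) + card (low ?H) + 1"
      by (metis card_Un_le add_le_mono1 le_trans is_singletonI is_singleton_altdef)
    moreover have "real (card (low H)) \<le> b" "real (card (low ?H)) \<le> b"
      using few mem step by auto
    moreover have "card S0 = n - card (low H \<union> low ?H \<union> {u})"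
      unfolding S0_def using lowV u rG finite_subset by (subst card_Diff_subset) auto
    ultimately have card: "real n - real (card S0) \<le> 2 * b + 1" by linarith
    \<comment> \<open>The vertices return one by one. Every intermediate set contains
      \<open>S0\<close> and avoids \<open>low H\<close>, as \<open>ext\<close> requires;
      \<open>u\<close> returns too unless it is low in \<open>H\<close>.\<close>
    have "induced H (S0 \<union> D) \<in> \<HH>" if "finite D" "D \<subseteq> ?V - low H" for D
      using that
    proof (induction D)
      case empty
      then show ?case using S0 by simp
    next
      case (insert x D)
      show ?case
      proof (cases "x \<in> S0")
        case True
        then have "S0 \<union> insert x D = S0 \<union> D" by auto
        then show ?thesis using insert by simp
      next
        case False
        let ?S = "S0 \<union> insert x D"
        have sub: "?S \<subseteq> ?V - low H" using insert.prems by (auto simp: S0_def)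
        then have "finite ?S" using rG(3) by (metis finite_Diff finite_subset)
        then have "card S0 \<le> card ?S" by (intro card_mono) auto
        then have "real n - real (card ?S) \<le> 2 * b + 1" using card by linarith
        moreover have "?S - {x} = S0 \<union> D" using False insert.hyps by auto
        ultimately show ?thesis
          using sub insert step(2,3) by (intro ext[OF mem(1), of ?S x]) auto
      qed
    qed
    from this[of "?V - low H"] have "induced H (S0 \<union> (?V - low H)) \<in> \<HH>" using rG(3) by simp
    moreover have "S0 \<union> (?V - low H) = verts H - low H" using step(2) by (auto simp: S0_def)
    ultimately show ?case by simp
  qed
qed

theorem theorem1p6:
  fixes r :: nat
    and \<Gamma> :: "'a::infinite hypergraph \<Rightarrow> real"
    and k \<delta>s cs Cs C :: real
    and \<HH> :: "'a hypergraph set"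
  assumes "r \<ge> 2"
    and "\<forall>G. rgraph r G \<longrightarrow> \<Gamma> G \<ge> 0"
    and "has_extremal r \<Gamma>"
    and "k_uniform r \<Gamma> k"
    and "nondegenerate r \<Gamma> k"
    and "0 < \<delta>s" "\<delta>s \<le> 1" "cs > 0" "Cs > 0"
    and "smooth r \<Gamma> k \<delta>s cs Cs"
    and "C > 0"
    and "locally_lipschitz r \<Gamma> k C"
    and "removal_continuous r \<Gamma>"
    and "locally_monotone r \<Gamma>"
    and "hereditary r \<HH>"
    and "symmetrization_increasing r \<Gamma>"
    and "symmetrized_stable r \<Gamma> \<HH>"
    and "vertex_extendable r \<Gamma> k \<HH>"
  shows "degree_stable r \<Gamma> k \<HH>"
proof -
  have k: "k > 0"
    using uniformity_constant_pos assms(2,3,5,11,12,14) by blast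
  obtain \<epsilon> \<sigma> where \<epsilon>: "\<epsilon> > 0" and \<sigma>: "\<sigma> > 0"
    and ext: "\<forall>\<^sub>F n in sequentially. \<forall>G\<in>rgraphs r n. \<forall>S\<subseteq>verts G. \<forall>v\<in>S.
      0 < \<Gamma> G \<and> (\<forall>w\<in>S. (1 - \<epsilon>) * exdeg r \<Gamma> k n \<le> gdeg \<Gamma> G w) \<and>
      real n - real (card S) \<le> \<sigma> * real n \<and> induced G (S - {v}) \<in> \<HH> \<longrightarrow> induced G S \<in> \<HH>"
    using vertex_extendable_induced[OF assms(2,3,5,10,6-9) k assms(11,12,18)] by blast
  \<comment> \<open>Two low sets of size at most \<open>\<sigma> * n / 4\<close> and one moved
    vertex stay below \<open>\<sigma> * n\<close> as soon as
    \<open>\<sigma> * n \<ge> 2\<close>.\<close>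
  have "0 < \<sigma> / 4" using \<sigma> by simp
  from few_low_degree_vertices[OF assms(2,3,5,14,10,6-9) k \<epsilon> this]
  obtain \<eta> where \<eta>: "0 < \<eta>" "\<eta> < 1"
    and few: "\<forall>\<^sub>F n in sequentially. \<forall>G\<in>rgraphs r n. (1 - \<eta>) * ex_num r \<Gamma> n \<le> \<Gamma> G \<longrightarrow>
      real (card {v \<in> verts G. gdeg \<Gamma> G v < (1 - \<epsilon>) * exdeg r \<Gamma> k n}) \<le> \<sigma> / 4 * real n"
    by blast
  obtain f where f: "f \<in> o(\<lambda>n. ex_num r \<Gamma> n)"
    and unif: "\<forall>n. \<forall>G\<in>rgraphs r n. \<Gamma> G > 0 \<longrightarrow> \<bar>(\<Sum>v\<in>verts G. gdeg \<Gamma> G v) - k * \<Gamma> G\<bar> \<le> f n"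
    using assms(4) unfolding k_uniform_def by (rule bexE)
  \<comment> \<open>The first bound empties the low set of \<open>G\<close>. The second spends half
    of \<open>\<eta>\<close> on the degree deficit and leaves the other half for the uniformity
    error.\<close>
  define \<epsilon>' where "\<epsilon>' = min \<epsilon> (\<eta> / 2)"
  have \<epsilon>': "0 < \<epsilon>'" "\<epsilon>' \<le> \<epsilon>" "\<epsilon>' \<le> \<eta> / 2" using \<epsilon> \<eta> by (auto simp: \<epsilon>'_def)
  have stable: "G \<in> \<HH>"
    if n: "0 < n" "0 < ex_num r \<Gamma> n" "\<bar>f n\<bar> \<le> k * \<eta> / 2 * \<bar>ex_num r \<Gamma> n\<bar>" "2 / \<sigma> \<le> real n"
      and extn: "\<forall>G\<in>rgraphs r n. \<forall>S\<subseteq>verts G. \<forall>v\<in>S.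
        0 < \<Gamma> G \<and> (\<forall>w\<in>S. (1 - \<epsilon>) * exdeg r \<Gamma> k n \<le> gdeg \<Gamma> G w) \<and>
        real n - real (card S) \<le> \<sigma> * real n \<and> induced G (S - {v}) \<in> \<HH> \<longrightarrow> induced G S \<in> \<HH>"
      and fewn: "\<forall>G\<in>rgraphs r n. (1 - \<eta>) * ex_num r \<Gamma> n \<le> \<Gamma> G \<longrightarrow>
        real (card {v \<in> verts G. gdeg \<Gamma> G v < (1 - \<epsilon>) * exdeg r \<Gamma> k n}) \<le> \<sigma> / 4 * real n"
      and G: "G \<in> rgraphs r n" and min: "(1 - \<epsilon>') * exdeg r \<Gamma> k n \<le> min_gdeg \<Gamma> G"
    for n G
  proof -
    let ?E = "ex_num r \<Gamma> n" and ?D = "exdeg r \<Gamma> k n"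
    define low where "low H = {v \<in> verts H. gdeg \<Gamma> H v < (1 - \<epsilon>) * ?D}" for H
    have rG: "rgraph r G" "finite (verts G)" "card (verts G) = n"
      using G by (auto simp: rgraphs_def rgraph_def)
    have D: "0 < ?D" using n k by (simp add: exdeg_def)
    have ne: "verts G \<noteq> {}" using rG(3) n(1) by auto
    have deg: "(1 - \<epsilon>') * ?D \<le> gdeg \<Gamma> G v" if "v \<in> verts G" for v
      using min that min_gdeg_ge_iff[OF rG(2) ne] by blast
    \<comment> \<open>Uniformity speaks only of positive graphs. Positivity follows from one vertex
      of positive degree, since \<open>\<Gamma>\<close> is nonnegative after deleting it.\<close>
    have pos: "0 < \<Gamma> G"
    proof -
      obtain v where v: "v \<in> verts G" using ne by blast
      have "rgraph r (delete_vertex G v)"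
        using rG(1) by (auto simp: rgraph_def delete_vertex_def)
      then have "0 \<le> \<Gamma> (delete_vertex G v)" using assms(2) by blast
      moreover have "0 < (1 - \<epsilon>') * ?D" using D \<epsilon>' \<eta> by simp
      ultimately show ?thesis using deg[OF v] by (simp add: gdeg_def)
    qed
    have large: "(1 - \<eta>) * ?E \<le> \<Gamma> G"
    proof -
      \<comment> \<open>Summing the degree bound over all \<open>n\<close> vertices gives near
        extremality, because \<open>n * exdeg\<close> equals \<open>k * ex_num\<close>.\<close>
      have "k * ((1 - \<epsilon>') * ?E) = (\<Sum>v\<in>verts G. (1 - \<epsilon>') * ?D)"
        using rG(3) n(1) by (simp add: exdeg_def)
      also have "\<dots> \<le> (\<Sum>v\<in>verts G. gdeg \<Gamma> G v)" by (intro sum_mono deg)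
      also have "\<dots> \<le> k * \<Gamma> G + f n" using unif G pos by (fastforce simp: abs_le_iff)
      also have "\<dots> \<le> k * (\<Gamma> G + \<eta> / 2 * ?E)" using n(2,3) by (simp add: algebra_simps)
      finally have "(1 - \<epsilon>') * ?E \<le> \<Gamma> G + \<eta> / 2 * ?E" using k by simp
      moreover have "(1 - \<eta> / 2) * ?E \<le> (1 - \<epsilon>') * ?E"
        using \<epsilon>' n(2) by (intro mult_right_mono) auto
      ultimately show ?thesis by (simp add: algebra_simps)
    qed
    have "induced G (verts G - low G) \<in> \<HH>"
    proof (rule induced_minus_low_mem[OF assms(16,17,15) _ G pos, where b = "\<sigma> / 4 * real n"])
      show "1 \<le> r" using assms(1) by simp
      show "low H \<subseteq> verts H" for H by (auto simp: low_def)
      show "real (card (low H)) \<le> \<sigma> / 4 * real n" if "H \<in> rgraphs r n" "\<Gamma> G \<le> \<Gamma> H" for H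
        using fewn that large unfolding low_def by (meson order_trans)
      show "induced H S \<in> \<HH>"
        if "H \<in> rgraphs r n" "\<Gamma> G \<le> \<Gamma> H" "S \<subseteq> verts H - low H" "v \<in> S"
          "real n - real (card S) \<le> 2 * (\<sigma> / 4 * real n) + 1" "induced H (S - {v}) \<in> \<HH>" for H S v
      proof -
        have "2 \<le> \<sigma> * real n" using n(4) \<sigma> by (simp add: field_simps)
        then have "real n - real (card S) \<le> \<sigma> * real n" using that(5) by linarith
        moreover have "\<forall>w\<in>S. (1 - \<epsilon>) * ?D \<le> gdeg \<Gamma> H w"
          using that(3) by (auto simp: low_def subset_iff not_less)
        moreover have "0 < \<Gamma> H" using pos that(2) by linarith
        moreover have "S \<subseteq> verts H" using that(3) by blast
        ultimately show ?thesis using extn that(1,4,6) by blast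
      qed
    qed
    moreover have "low G = {}"
    proof -
      have "(1 - \<epsilon>) * ?D \<le> (1 - \<epsilon>') * ?D" using D \<epsilon>' by (intro mult_right_mono) auto
      then show ?thesis using deg by (fastforce simp: low_def)
    qed
    ultimately show ?thesis using rG(1) by (simp add: induced_verts)
  qed
  have "0 < k * \<eta> / 2" using k \<eta> by simp
  from landau_o.smallD[OF f this]
  have "\<forall>\<^sub>F n in sequentially. \<bar>f n\<bar> \<le> k * \<eta> / 2 * \<bar>ex_num r \<Gamma> n\<bar>" by simp
  moreover have "\<forall>\<^sub>F n in sequentially. 2 / \<sigma> \<le> real n"
    using eventually_ge_at_top[of "nat \<lceil>2 / \<sigma>\<rceil>"] by eventually_elim linarith
  ultimately have "\<forall>\<^sub>F n in sequentially. \<forall>G\<in>rgraphs r n.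
      (1 - \<epsilon>') * exdeg r \<Gamma> k n \<le> min_gdeg \<Gamma> G \<longrightarrow> G \<in> \<HH>"
    using eventually_ex_num_pos[OF assms(2,3,5)] ext few
  proof eventually_elim
    case (elim n)
    then show ?case using stable[of n] by blast
  qed
  then show ?thesis
    unfolding degree_stable_def eventually_sequentially using \<epsilon>'(1) by blast
qed

end
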